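(* Let $k \geq 1$ be an integer and let $G$ be a $k$-connected graph with $n \geq 9$ vertices and $e$ edges, minimum degree $\delta$ and maximum degree $\Delta$. If $$M_1(G) \geq (n - k - 2)\Delta^2 + \frac{\bigl(e(\delta + n - k - 2)\bigr)^2}{4 \delta (n - k - 2)(k + 2)},$$ then $G$ is traceable or $G$ is the complete bipartite graph $K_{k,\, k+2}$.
   Context: All graphs are finite, undirected, without loops or multiple edges. For a graph $G$, $d_G(u)$ denotes the degree of a vertex $u$, $\delta$ and $\Delta$ denote the minimum and maximum degree of $G$, and the first Zagreb index is $M_1(G) = \sum_{u \in V(G)} d_G^2(u)$. A graph is traceable if it has a path containing all its vertices. $K_{a,b}$ denotes the complete bipartite graph with parts of sizes $a$ and $b$. *)

theory Defs
  imports Complex_Main "Graph_Theory.Graph_Theory"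
begin

text \<open>
  A finite simple undirected graph is a digraph satisfying \<^locale>\<open>graph\<close>: finite, loop-free,
  without parallel arcs, and symmetric. An undirected edge is thus a pair of opposite arcs, the
  degree of a vertex is its out-degree (which equals its in-degree), and the number of edges is
  the number of unordered pairs of adjacent vertices, not the number of arcs.
\<close>

definition edges :: "('a, 'b) pre_digraph \<Rightarrow> 'a set set" where
  "edges G = {{u, v} | u v. (u, v) \<in> arcs_ends G}"

definition degree :: "('a, 'b) pre_digraph \<Rightarrow> 'a \<Rightarrow> nat" where
  "degree G u = out_degree G u"

definition min_degree :: "('a, 'b) pre_digraph \<Rightarrow> nat" where
  "min_degree G = Min (degree G ` verts G)"

definition max_degree :: "('a, 'b) pre_digraph \<Rightarrow> nat" where
  "max_degree G = Max (degree G ` verts G)"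

definition first_zagreb_index :: "('a, 'b) pre_digraph \<Rightarrow> nat" where
  "first_zagreb_index G = (\<Sum>u\<in>verts G. (degree G u)\<^sup>2)"

text \<open>
  With this convention the complete graph on \<open>n\<close> vertices is \<open>k\<close>-connected exactly for
  \<open>k \<le> n - 1\<close>. The name \<open>connected\<close> is qualified because it also denotes connectedness of
  subsets of a topological space.
\<close>

definition k_connected :: "nat \<Rightarrow> ('a, 'b) pre_digraph \<Rightarrow> bool" where
  "k_connected k G \<longleftrightarrow> k < card (verts G) \<and>
    (\<forall>S \<subseteq> verts G. card S < k \<longrightarrow> Digraph_Component.connected (G \<restriction> (verts G - S)))"

definition traceable :: "('a, 'b) pre_digraph \<Rightarrow> bool" where
  "traceable G \<longleftrightarrow> (\<exists>u p v. pre_digraph.apath G u p v \<and>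
    set (pre_digraph.awalk_verts G u p) = verts G)"

end

theory Submission
  imports Defs
begin

text \<open>
  A \<open>k\<close>-connected graph without a Hamiltonian path contains an independent set \<open>I\<close> of size
  \<open>k + 2\<close>, by a Chvatal--Erdos argument. With \<open>N = n - k - 2\<close>, all degrees in \<open>I\<close> lie between
  \<open>\<delta>\<close> and \<open>N\<close> and sum up to at most \<open>e\<close>, so the Polya--Szego inequality bounds the contribution
  of \<open>I\<close> to the Zagreb index by the second summand of the hypothesis, while the other \<open>N\<close> vertices
  contribute at most \<open>N \<Delta>\<^sup>2\<close>. Hence all these estimates are equalities: the graph is bipartite
  with parts \<open>I\<close> and \<open>V - I\<close>, the degrees in \<open>V - I\<close> are \<open>\<Delta>\<close> and those in \<open>I\<close> are \<open>\<delta>\<close> or \<open>N\<close>.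
  If \<open>\<delta> < N\<close>, counting edges forces \<open>n = 5\<close>; otherwise the graph is complete bipartite with
  \<open>k \<le> N \<le> k + 2\<close>, and it has a Hamiltonian path unless \<open>N = k\<close>.
\<close>

section \<open>Paths in a finite symmetric adjacency relation\<close>

text \<open>Extend the path one step at a time; if the new vertex already lies on it, cut the path
  off there. The last conclusion keeps a detour inside the component of its start.\<close>

lemma rtranclp_imp_distinct_path:
  assumes "R\<^sup>*\<^sup>* x y"
  obtains p where "p \<noteq> []" "distinct p" "hd p = x" "last p = y" "successively R p"
    "set p \<subseteq> {v. R\<^sup>*\<^sup>* x v}"
proof -
  from assms have "\<exists>p. p \<noteq> [] \<and> distinct p \<and> hd p = x \<and> last p = y \<and> successively R p
    \<and> set p \<subseteq> {v. R\<^sup>*\<^sup>* x v}"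
  proof induction
    case base
    show ?case by (rule exI[of _ "[x]"]) auto
  next
    case (step y z)
    then obtain p where p: "p \<noteq> []" "distinct p" "hd p = x" "last p = y" "successively R p"
      "set p \<subseteq> {v. R\<^sup>*\<^sup>* x v}" by blast
    show ?case
    proof (cases "z \<in> set p")
      case True
      then obtain us vs where "p = us @ z # vs" by (meson split_list)
      then have "p = (us @ [z]) @ vs" by simp
      then show ?thesis using p
        by (intro exI[of _ "us @ [z]"]) (auto simp: successively_append_iff hd_append split: if_splits)
    next
      case False
      have "R\<^sup>*\<^sup>* x z" using step.hyps by auto
      then show ?thesis using p False step.hyps
        by (intro exI[of _ "p @ [z]"]) (auto simp: successively_append_iff)
    qed
  qed
  then show thesis using that by blast
qed

text \<open>Arcs are forgotten in favour of a symmetric irreflexive relation, so that paths become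
  plain vertex lists that can be cut, reversed and glued.\<close>

locale finite_adjacency =
  fixes V :: "'a set" and E :: "'a \<Rightarrow> 'a \<Rightarrow> bool"
  assumes finite_V: "finite V"
    and E_sym: "E u v \<Longrightarrow> E v u"
    and E_irrefl: "\<not> E u u"
    and E_in_V: "E u v \<Longrightarrow> u \<in> V"
begin

definition path :: "'a list \<Rightarrow> bool" where
  "path xs \<longleftrightarrow> distinct xs \<and> set xs \<subseteq> V \<and> successively E xs"

definition independent :: "'a set \<Rightarrow> bool" where
  "independent I \<longleftrightarrow> I \<subseteq> V \<and> (\<forall>u\<in>I. \<forall>v\<in>I. \<not> E u v)"

definition connected_without :: "'a set \<Rightarrow> bool" where
  "connected_without S \<longleftrightarrow>
    (\<forall>x\<in>V - S. \<forall>y\<in>V - S. (\<lambda>u v. E u v \<and> u \<in> V - S \<and> v \<in> V - S)\<^sup>*\<^sup>* x y)"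

text \<open>Lets the simplifier treat a reversed piece of a path as a path again.\<close>

lemma successively_rev_E [simp]: "successively (\<lambda>x y. E y x) xs \<longleftrightarrow> successively E xs"
proof -
  have "(\<lambda>x y. E y x) = E" using E_sym by blast
  then show ?thesis by (rule arg_cong)
qed

lemma path_length_le: "path xs \<Longrightarrow> length xs \<le> card V"
  unfolding path_def by (metis card_mono distinct_card finite_V)

lemma exists_longest_path:
  obtains xs where "path xs" "\<And>ys. path ys \<Longrightarrow> length ys \<le> length xs"
proof -
  have "path []" by (simp add: path_def)
  then obtain xs where "path xs" "\<forall>ys. path ys \<longrightarrow> length ys \<le> length xs"
    using ex_has_greatest_nat[of path "[]" length "Suc (card V)"] path_length_le
    by (metis less_Suc_eq_le)
  then show thesis using that by simp
qed

section \<open>The Chvatal-Erdos argument on a longest path\<close>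

text \<open>
  Consider a component \<open>H\<close> of the complement of a longest path. The
  neighbours of \<open>H\<close> on the path form a cut set, so there are at least \<open>k\<close> of them, and their
  successors together with the first vertex of the path and a vertex of \<open>H\<close> are independent,
  because any edge between them would allow a detour through \<open>H\<close> giving a longer path.
\<close>
theorem hamiltonian_path_or_large_independent_set:
  assumes k_conn: "\<And>S. S \<subseteq> V \<Longrightarrow> card S < k \<Longrightarrow> connected_without S"
  obtains xs where "path xs" "set xs = V" | I where "independent I" "card I = k + 2"
proof -
  obtain xs where xs: "path xs" and longest: "\<And>ys. path ys \<Longrightarrow> length ys \<le> length xs"
    using exists_longest_path by blast
  have xsV: "set xs \<subseteq> V" and dist: "distinct xs" and succ: "successively E xs"
    using xs by (auto simp: path_def)
  have "\<exists>I. independent I \<and> card I = k + 2" if "set xs \<noteq> V"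
  proof -
    obtain h0 where h0: "h0 \<in> V" "h0 \<notin> set xs" using xsV \<open>set xs \<noteq> V\<close> by blast
    have ne: "xs \<noteq> []" using longest[of "[h0]"] h0 by (auto simp: path_def)
    define R where "R = (\<lambda>u v. E u v \<and> u \<in> V - set xs \<and> v \<in> V - set xs)"
    define H where "H = {y. R\<^sup>*\<^sup>* h0 y}"
    have symR: "symp R" unfolding R_def by (auto intro: sympI E_sym)
    have h0H: "h0 \<in> H" by (simp add: H_def)
    have H_out: "y \<in> V - set xs" if "y \<in> H" for y
      using that unfolding H_def mem_Collect_eq by induction (use h0 in \<open>auto simp: R_def\<close>)
    have H_closed: "z \<in> H" if "y \<in> H" "E y z" "z \<notin> set xs" for y z
    proof -
      have "R y z" using that H_out[of y] E_in_V[OF E_sym] by (auto simp: R_def)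
      then show ?thesis using \<open>y \<in> H\<close> by (auto simp: H_def)
    qed
    have H_path: "\<exists>p. p \<noteq> [] \<and> path p \<and> set p \<inter> set xs = {} \<and> hd p = y \<and> last p = z"
      if "y \<in> H" "z \<in> H" for y z
    proof -
      \<comment> \<open>By symmetry, walk from \<open>y\<close> back to \<open>h0\<close> and then
        on to \<open>z\<close>.\<close>
      have "R\<^sup>*\<^sup>* y z"
        using that symR unfolding H_def
        by (metis (no_types, lifting) mem_Collect_eq rtranclp_trans sympD symp_rtranclp)
      then obtain p where p: "p \<noteq> []" "distinct p" "hd p = y" "last p = z" "successively R p"
        "set p \<subseteq> {v. R\<^sup>*\<^sup>* y v}" by (rule rtranclp_imp_distinct_path)
      have "set p \<subseteq> H" using p(6) \<open>y \<in> H\<close> by (auto simp: H_def)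
      then have "set p \<subseteq> V - set xs" using H_out by blast
      moreover have "successively E p"
        using p(5) by (rule successively_mono) (simp add: R_def)
      ultimately show ?thesis using p by (auto simp: path_def)
    qed
    define A where "A = {a \<in> set xs. \<exists>h\<in>H. E a h}"
    have no_detour: False if "path ys" "length ys > length xs" for ys
      using longest[of ys] that by simp
    \<comment> \<open>Otherwise a vertex of \<open>H\<close> could be prepended to the path; at the
      other end, likewise, one could be appended.\<close>
    have hd_notin: "hd xs \<notin> A"
    proof
      assume "hd xs \<in> A"
      then obtain h where "h \<in> H" "E (hd xs) h" by (auto simp: A_def)
      then have "path (h # xs)"
        using H_out[of h] xs E_sym by (auto simp: path_def successively_Cons)
      then show False using no_detour by fastforce
    qed
    have last_notin: "last xs \<notin> A"
    proof
      assume "last xs \<in> A"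
      then obtain h where "h \<in> H" "E (last xs) h" by (auto simp: A_def)
      then have "path (xs @ [h])"
        using H_out[of h] xs E_sym by (auto simp: path_def successively_append_iff)
      then show False using no_detour by fastforce
    qed
    have cardA: "card A \<ge> k"
    proof (rule ccontr)
      assume "\<not> card A \<ge> k"
      moreover have "A \<subseteq> V" using xsV by (auto simp: A_def)
      ultimately have "connected_without A" using k_conn by simp
      moreover have "h0 \<in> V - A" "hd xs \<in> V - A"
        using h0 hd_notin ne xsV by (auto simp: A_def)
      ultimately have "(\<lambda>u v. E u v \<and> u \<in> V - A \<and> v \<in> V - A)\<^sup>*\<^sup>* h0 (hd xs)"
        by (auto simp: connected_without_def)
      \<comment> \<open>A walk from \<open>h0\<close> that avoids \<open>A\<close> never leaves
        \<open>H\<close>, since the vertex at which it first met the path would belong to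
        \<open>A\<close>.\<close>
      then have "hd xs \<in> H"
      proof induction
        case (step y z)
        then show ?case using H_closed[of y z] E_sym[of y z] by (auto simp: A_def)
      qed (rule h0H)
      then show False using H_out[of "hd xs"] ne by simp
    qed
    \<comment> \<open>Positions instead of vertices, so that successors are available;
      \<open>last_notin\<close> ensures that each of them exists.\<close>
    define J where "J = {i. i < length xs \<and> xs ! i \<in> A}"
    have J_Suc: "Suc i < length xs" if "i \<in> J" for i
    proof (rule ccontr)
      assume "\<not> Suc i < length xs"
      then have "xs ! i = last xs" using that ne by (auto simp: J_def last_conv_nth le_Suc_eq not_less)
      then show False using that last_notin by (simp add: J_def)
    qed
    have J_adj: "\<exists>h\<in>H. E (xs ! i) h" if "i \<in> J" for i using that by (simp add: J_def A_def)
    \<comment> \<open>A path through \<open>H\<close> could be inserted between two consecutive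
      vertices of \<open>A\<close>.\<close>
    have consecutive: "Suc i \<notin> J" if i: "i \<in> J" for i
    proof
      assume si: "Suc i \<in> J"
      obtain h h' where h: "h \<in> H" "E (xs ! i) h" "h' \<in> H" "E (xs ! Suc i) h'"
        using J_adj i si by blast
      obtain p where p: "p \<noteq> []" "path p" "set p \<inter> set xs = {}" "hd p = h" "last p = h'"
        using H_path h by blast
      define us vs where "us = take (Suc i) xs" and "vs = drop (Suc i) xs"
      have split: "xs = us @ vs" by (simp add: us_def vs_def)
      have ends: "us \<noteq> []" "vs \<noteq> []" "last us = xs ! i" "hd vs = xs ! Suc i"
        using J_Suc[OF i] ne
        by (auto simp: us_def vs_def hd_drop_conv_nth take_Suc_conv_app_nth)
      have "E (last us) (hd p)" "E (last p) (hd vs)" using h E_sym[OF h(4)] ends p by simp_all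
      moreover have "path (us @ vs)" "set p \<inter> set (us @ vs) = {}" using xs p split by simp_all
      ultimately have "path (us @ p @ vs)"
        using p(1,2) by (auto simp: path_def successively_append_iff hd_append)
      then show False using no_detour[of "us @ p @ vs"] p(1) split by auto
    qed
    \<comment> \<open>Start in \<open>H\<close>, enter at position \<open>i\<close>, run back to the
      first vertex, then use the assumed edge to jump to position \<open>Suc i\<close> and
      continue.\<close>
    have first: "\<not> E (hd xs) (xs ! Suc i)" if i: "i \<in> J" for i
    proof
      assume e: "E (hd xs) (xs ! Suc i)"
      obtain h where h: "h \<in> H" "E (xs ! i) h" using J_adj i by blast
      define us vs where "us = take (Suc i) xs" and "vs = drop (Suc i) xs"
      have split: "xs = us @ vs" by (simp add: us_def vs_def)
      have ends: "us \<noteq> []" "vs \<noteq> []" "last us = xs ! i" "hd vs = xs ! Suc i"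
        using J_Suc[OF i] ne
        by (auto simp: us_def vs_def hd_drop_conv_nth take_Suc_conv_app_nth)
      have "hd us = hd xs" by (simp add: us_def)
      have "E h (last us)" "E (hd us) (hd vs)" using E_sym[OF h(2)] ends e \<open>hd us = hd xs\<close> by simp_all
      moreover have "path (us @ vs)" "h \<in> V - set (us @ vs)" using xs H_out[OF h(1)] split by simp_all
      ultimately have "path (h # rev us @ vs)"
        using ends(1,2)
        by (auto simp: path_def successively_append_iff successively_Cons hd_rev last_rev)
      then show False using no_detour[of "h # rev us @ vs"] split by auto
    qed
    \<comment> \<open>Leave at position \<open>i\<close> through \<open>H\<close>, re-enter at
      \<open>j\<close>, run back to \<open>Suc i\<close>, then take the assumed edge to
      \<open>Suc j\<close>.\<close>
    have crossing: False if i: "i \<in> J" and j: "j \<in> J" and "i < j"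
      and e: "E (xs ! Suc i) (xs ! Suc j)" for i j
    proof -
      obtain h h' where h: "h \<in> H" "E (xs ! i) h" "h' \<in> H" "E (xs ! j) h'"
        using J_adj i j by blast
      obtain p where p: "p \<noteq> []" "path p" "set p \<inter> set xs = {}" "hd p = h" "last p = h'"
        using H_path h by blast
      define us ms vs where "us = take (Suc i) xs" and "ms = drop (Suc i) (take (Suc j) xs)"
        and "vs = drop (Suc j) xs"
      have "us = take (Suc i) (take (Suc j) xs)" using \<open>i < j\<close> by (simp add: us_def min_def)
      then have "us @ ms = take (Suc j) xs" unfolding ms_def by (simp only: append_take_drop_id)
      then have split: "xs = us @ ms @ vs" unfolding vs_def
        by (metis append.assoc append_take_drop_id)
      have lj: "Suc j < length xs" using J_Suc[OF j] .
      have "hd ms = xs ! Suc i"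
        unfolding ms_def using lj \<open>i < j\<close> by (subst hd_drop_conv_nth) auto
      have ends: "us \<noteq> []" "ms \<noteq> []" "vs \<noteq> []" "last us = xs ! i" "last ms = xs ! j"
        "hd vs = xs ! Suc j"
        using lj ne \<open>i < j\<close>
        by (auto simp: us_def ms_def vs_def hd_drop_conv_nth take_Suc_conv_app_nth last_drop)
      have "E (last us) (hd p)" "E (last p) (last ms)" "E (hd ms) (hd vs)"
        using h E_sym[OF h(4)] e ends p \<open>hd ms = xs ! Suc i\<close> by simp_all
      moreover have "path (us @ ms @ vs)" "set p \<inter> set (us @ ms @ vs) = {}"
        using xs p split by simp_all
      ultimately have "path (us @ p @ rev ms @ vs)"
        using p(1,2) ends(1-3) by (auto simp: path_def successively_append_iff hd_rev last_rev)
      then show False using no_detour[of "us @ p @ rev ms @ vs"] p(1) split by auto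
    qed
    define succs where "succs = (\<lambda>i. xs ! Suc i) ` J"
    have finJ: "finite J" by (simp add: J_def)
    have "A = (!) xs ` J" by (force simp: J_def A_def in_set_conv_nth)
    then have "k \<le> card J" using cardA card_image_le[OF finJ, of "(!) xs"] by simp
    also have "card J = card succs"
      unfolding succs_def
      by (rule card_image[symmetric]) (use J_Suc dist in \<open>auto intro!: inj_onI simp: nth_eq_iff_index_eq\<close>)
    finally have cs: "k \<le> card succs" .
    have succs_sub: "succs \<subseteq> set xs" using J_Suc by (auto simp: succs_def)
    have hd_succs: "hd xs \<notin> succs"
      using J_Suc dist ne by (force simp: succs_def hd_conv_nth nth_eq_iff_index_eq)
    define I where "I = insert h0 (insert (hd xs) succs)"
    have "card I = card succs + 2"
      using hd_succs succs_sub h0 ne finJ unfolding I_def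
      by (subst card_insert_disjoint) (auto simp: succs_def)
    then have "k + 2 \<le> card I" using cs by simp
    \<comment> \<open>Such an edge would put the successor itself into \<open>A\<close>, against
      \<open>consecutive\<close>.\<close>
    have h0_succ: "\<not> E h0 (xs ! Suc i)" if i: "i \<in> J" for i
      using consecutive[OF i] J_Suc[OF i] h0H E_sym by (auto simp: J_def A_def)
    have h0_hd: "\<not> E h0 (hd xs)" using hd_notin h0H E_sym ne by (auto simp: A_def)
    have succ_succ: "\<not> E (xs ! Suc i) (xs ! Suc j)" if "i \<in> J" "j \<in> J" for i j
      using crossing[of i j] crossing[of j i] that E_sym E_irrefl by (metis linorder_neqE_nat)
    have "independent I"
      unfolding independent_def
    proof (intro conjI ballI)
      show "I \<subseteq> V" using succs_sub xsV h0 ne by (auto simp: I_def)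
      show "\<not> E u v" if "u \<in> I" "v \<in> I" for u v
        using that h0_succ h0_hd succ_succ first E_irrefl E_sym unfolding I_def succs_def by blast
    qed
    moreover obtain I' where I': "I' \<subseteq> I" "card I' = k + 2"
      by (rule obtain_subset_with_card_n[OF \<open>k + 2 \<le> card I\<close>])
    ultimately have "independent I'" by (auto simp: independent_def)
    then show ?thesis using I'(2) by blast
  qed
  then show thesis using that xs by blast
qed

section \<open>Degrees and edge counting\<close>

definition nbrs :: "'a \<Rightarrow> 'a set" where
  "nbrs u = {v. E u v}"

definition deg :: "'a \<Rightarrow> nat" where
  "deg u = card (nbrs u)"

definition edge_set :: "'a set set" where
  "edge_set = {{u, v} | u v. E u v}"

lemma nbrs_subset: "nbrs u \<subseteq> V"
  using E_in_V E_sym by (auto simp: nbrs_def)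

lemma finite_nbrs: "finite (nbrs u)"
  using nbrs_subset finite_V finite_subset by blast

lemma finite_edge_set: "finite edge_set"
proof -
  have "edge_set \<subseteq> Pow V" using E_in_V E_sym by (auto simp: edge_set_def)
  then show ?thesis using finite_V by (simp add: finite_subset)
qed

text \<open>Fewer than \<open>k\<close> neighbours would form a set whose deletion isolates
  \<open>u\<close> from some remaining vertex \<open>w\<close>, which exists because
  \<open>k < card V\<close>.\<close>

lemma deg_ge_connectivity:
  assumes k_conn: "\<And>S. S \<subseteq> V \<Longrightarrow> card S < k \<Longrightarrow> connected_without S"
    and "k < card V" and u: "u \<in> V"
  shows "k \<le> deg u"
proof (rule ccontr)
  assume "\<not> k \<le> deg u"
  then have lt: "card (nbrs u) < k" by (simp add: deg_def)
  have "card (insert u (nbrs u)) < card V"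
    using lt \<open>k < card V\<close> finite_nbrs[of u] by (simp add: card_insert_if)
  then obtain w where w: "w \<in> V" "w \<notin> insert u (nbrs u)"
    by (metis card_mono finite_insert finite_nbrs linorder_not_le subsetI)
  have "(\<lambda>x y. E x y \<and> x \<in> V - nbrs u \<and> y \<in> V - nbrs u)\<^sup>*\<^sup>* u w"
    using k_conn[OF nbrs_subset lt] w u E_irrefl by (auto simp: connected_without_def nbrs_def)
  then show False
    by (rule converse_rtranclpE) (use w in \<open>auto simp: nbrs_def\<close>)
qed

lemma sum_deg_eq_card_Sigma: "finite I \<Longrightarrow> (\<Sum>u\<in>I. deg u) = card (Sigma I nbrs)"
  by (simp add: deg_def finite_nbrs)

text \<open>No edge has both ends in \<open>I\<close>, so sending a pair (vertex of
  \<open>I\<close>, neighbour) to its edge is injective. If it is also onto, every edge meets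
  \<open>I\<close>.\<close>

lemma independent_edge_count:
  assumes I: "independent I"
  shows "(\<Sum>u\<in>I. deg u) \<le> card edge_set"
    and "(\<Sum>u\<in>I. deg u) = card edge_set \<Longrightarrow> independent (V - I)"
proof -
  have finI: "finite I" using I finite_V by (auto simp: independent_def intro: finite_subset)
  let ?f = "\<lambda>(u, v). {u, v}"
  have inj: "inj_on ?f (Sigma I nbrs)"
    using I by (auto simp: inj_on_def independent_def nbrs_def doubleton_eq_iff)
  have sub: "?f ` Sigma I nbrs \<subseteq> edge_set" by (fastforce simp: edge_set_def nbrs_def)
  have eq: "(\<Sum>u\<in>I. deg u) = card (?f ` Sigma I nbrs)"
    by (simp add: card_image[OF inj] sum_deg_eq_card_Sigma[OF finI])
  show "(\<Sum>u\<in>I. deg u) \<le> card edge_set"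
    unfolding eq using sub finite_edge_set by (rule card_mono[rotated])
  assume "(\<Sum>u\<in>I. deg u) = card edge_set"
  then have im: "?f ` Sigma I nbrs = edge_set"
    unfolding eq by (rule card_subset_eq[OF finite_edge_set sub])
  have "\<not> E u v" if "u \<in> V - I" "v \<in> V - I" for u v
  proof
    assume "E u v"
    then have "{u, v} \<in> ?f ` Sigma I nbrs" unfolding im by (auto simp: edge_set_def)
    then show False using that by (auto simp: doubleton_eq_iff)
  qed
  then show "independent (V - I)" by (simp add: independent_def)
qed

text \<open>Both sums count the edges between the parts; swapping the pairs is the
  bijection.\<close>

lemma bipartite_sum_deg_eq:
  assumes I: "independent I" and W: "independent (V - I)"
  shows "(\<Sum>u\<in>I. deg u) = (\<Sum>w\<in>V - I. deg w)"
proof -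
  have finI: "finite I" using I finite_V by (auto simp: independent_def intro: finite_subset)
  have "prod.swap ` Sigma I nbrs = Sigma (V - I) nbrs"
  proof (rule set_eqI)
    fix e :: "'a \<times> 'a"
    obtain u v where e: "e = (u, v)" by (cases e)
    have "v \<in> I \<and> E v u \<longleftrightarrow> u \<in> V - I \<and> E u v"
      using I W E_in_V[of u v] E_in_V[of v u] E_sym[of u v] E_sym[of v u]
      unfolding independent_def by blast
    then show "e \<in> prod.swap ` Sigma I nbrs \<longleftrightarrow> e \<in> Sigma (V - I) nbrs"
      by (simp add: e nbrs_def)
  qed
  moreover have "card (prod.swap ` Sigma I nbrs) = card (Sigma I nbrs)"
    by (simp add: card_image)
  ultimately show ?thesis using finI finite_V by (simp add: sum_deg_eq_card_Sigma)
qed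

end

section \<open>Numerical equality cases\<close>

text \<open>
  Summing \<open>(d i - a) * (b - d i) \<ge> 0\<close> and applying AM--GM gives the reverse of \<open>ge\<close>, so both
  steps are equalities.
\<close>
lemma polya_szego_equality:
  fixes d :: "'a \<Rightarrow> real"
  assumes "finite I" "I \<noteq> {}" "0 < a" "a \<le> b" and bounds: "\<forall>i\<in>I. a \<le> d i \<and> d i \<le> b"
    and s: "sum d I \<le> s"
    and ge: "(s * (a + b))\<^sup>2 / (4 * a * b * card I) \<le> (\<Sum>i\<in>I. (d i)\<^sup>2)"
  shows "\<And>i. i \<in> I \<Longrightarrow> d i = a \<or> d i = b"
    and "(a + b) * sum d I = 2 * a * b * card I"
    and "sum d I = s"
    and "(\<Sum>i\<in>I. (d i)\<^sup>2) = (s * (a + b))\<^sup>2 / (4 * a * b * card I)"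
proof -
  define c where "c = a * b * card I"
  define x where "x = sum d I * (a + b)"
  define y where "y = s * (a + b)"
  define q where "q = (\<Sum>i\<in>I. (d i)\<^sup>2)"
  have "card I > 0" using assms(1,2) by (simp add: card_gt_0_iff)
  then have c: "c > 0" using assms(3,4) by (simp add: c_def)
  have "0 \<le> sum d I" using bounds assms(3) by (intro sum_nonneg) force
  then have x0: "0 \<le> x" using assms(3,4) by (simp add: x_def)
  have xy: "x \<le> y" using s assms(3,4) by (simp add: x_def y_def)
  have "(\<Sum>i\<in>I. (d i - a) * (b - d i)) = (\<Sum>i\<in>I. d i * (a + b) - (d i)\<^sup>2 - a * b)"
    by (rule sum.cong) (auto simp: algebra_simps power2_eq_square)
  also have "\<dots> = x - q - c"
    by (simp add: sum_subtractf x_def q_def c_def sum_distrib_right)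
  finally have sum0: "(\<Sum>i\<in>I. (d i - a) * (b - d i)) = x - q - c" .
  have nonneg: "0 \<le> (d i - a) * (b - d i)" if "i \<in> I" for i using bounds that by simp
  have q_le: "q \<le> x - c" using sum_nonneg[of I "\<lambda>i. (d i - a) * (b - d i)"] nonneg sum0 by simp
  have yq: "y\<^sup>2 \<le> 4 * c * q"
    using ge c by (simp add: y_def q_def c_def field_simps)
  have "x\<^sup>2 \<le> y\<^sup>2" using x0 xy by (simp add: power_mono)
  moreover have "4 * c * q \<le> 4 * c * (x - c)" using q_le c by simp
  moreover have "4 * c * (x - c) = x\<^sup>2 - (x - 2 * c)\<^sup>2" by (simp add: power2_eq_square algebra_simps)
  \<comment> \<open>The chain \<open>y\<^sup>2 \<le> 4 * c * q \<le> 4 * c * (x - c) = x\<^sup>2 -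
    (x - 2 * c)\<^sup>2 \<le> y\<^sup>2 - (x - 2 * c)\<^sup>2\<close> closes up, so every link is an
    equality.\<close>
  ultimately have eqs: "(x - 2 * c)\<^sup>2 \<le> 0" "x\<^sup>2 = y\<^sup>2" "4 * c * q = 4 * c * (x - c)" "y\<^sup>2 = 4 * c * q"
    using yq zero_le_power2[of "x - 2 * c"] by linarith+
  have x: "x = 2 * c" using eqs(1) by simp
  have "x = y" using eqs(2) x0 xy unfolding power2_eq_iff by linarith
  have q: "q = x - c" using eqs(3) c by simp
  show "(a + b) * sum d I = 2 * a * b * card I" using x by (simp add: x_def c_def algebra_simps)
  show "sum d I = s" using \<open>x = y\<close> assms(3,4) by (simp add: x_def y_def)
  show "(\<Sum>i\<in>I. (d i)\<^sup>2) = (s * (a + b))\<^sup>2 / (4 * a * b * card I)"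
    using eqs(4) c \<open>card I > 0\<close> assms(3,4) by (simp add: y_def q_def c_def field_simps)
  show "d i = a \<or> d i = b" if "i \<in> I" for i
  proof -
    have "\<forall>i\<in>I. (d i - a) * (b - d i) = 0"
      using sum0 q nonneg assms(1) by (subst sum_nonneg_eq_0_iff[symmetric]) auto
    then show ?thesis using that by auto
  qed
qed

text \<open>
  Here \<open>p\<close> and \<open>q\<close> count the vertices of the independent set having degree \<open>\<delta>\<close> and \<open>N\<close>; the
  only solution is \<open>p = 2\<close>, \<open>q = 1\<close>.
\<close>
lemma unbalanced_equality_case:
  fixes p q \<delta> N \<Delta> k :: nat
  assumes "p + q = k + 2" "p * \<delta> = q * N" "k \<le> \<delta>" "\<delta> < N" "p * \<delta> + q * N = N * \<Delta>"
    and "1 \<le> k" and "q > 0 \<Longrightarrow> N \<le> \<Delta>"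
  shows "N = 2 \<and> k = 1"
proof -
  have "q > 0" using assms(1-3,6) by (cases q) auto
  then have "N \<le> \<Delta>" using assms(7) by simp
  have "N * \<Delta> = q * N + q * N" using assms(2,5) by linarith
  then have "N * \<Delta> = N * (2 * q)" by algebra
  then have \<Delta>: "\<Delta> = 2 * q" using assms(4) by simp
  have "q < p"
  proof (rule ccontr)
    assume "\<not> q < p"
    then have "p * \<delta> \<le> q * \<delta>" by simp
    also have "\<dots> < q * N" using \<open>q > 0\<close> assms(4) by simp
    finally show False using assms(2) by simp
  qed
  \<comment> \<open>The chain \<open>2 * q + 1 \<ge> N + 1 \<ge> \<delta> + 2 \<ge> k + 2 = p + q
    \<ge> 2 * q + 1\<close> collapses to equalities.\<close>
  then have "N = 2 * q" "\<delta> = k" "k + 1 = 2 * q" "p = q + 1"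
    using \<Delta> \<open>N \<le> \<Delta>\<close> assms(1,3,4) by linarith+
  moreover have "(q + 1) * k = q * (k + 1)"
    using assms(2) \<open>N = 2 * q\<close> \<open>\<delta> = k\<close> \<open>k + 1 = 2 * q\<close> \<open>p = q + 1\<close> by metis
  then have "k = q" by simp
  ultimately show ?thesis by simp
qed

section \<open>Alternating lists, and the passage from digraphs to adjacency relations\<close>

text \<open>Each step of \<open>splice\<close> exchanges the roles of the two lists. The length
  condition survives this exchange, and \<open>P\<close> is assumed in both directions because of
  it.\<close>

lemma successively_splice:
  assumes "\<And>a b. a \<in> set as \<Longrightarrow> b \<in> set bs \<Longrightarrow> P a b \<and> P b a"
    and "length bs \<le> length as" "length as \<le> Suc (length bs)"
  shows "successively P (splice as bs)"
  using assms
proof (induction as bs rule: splice.induct)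
  case (2 a as bs)
  have "successively P (splice bs as)" using 2 by simp
  then show ?case
  proof (cases bs)
    case Nil
    then show ?thesis using 2(4) by simp
  next
    case (Cons b bs')
    then have "P a b" using 2(2)[of a b] by simp
    then show ?thesis using \<open>successively P (splice bs as)\<close> Cons by simp
  qed
qed simp

text \<open>Without parallel arcs, \<open>head G\<close> is injective on the arcs leaving
  \<open>u\<close>.\<close>

lemma degree_eq_card_successors:
  assumes "nomulti_digraph G"
  shows "degree G u = card {v. (u, v) \<in> arcs_ends G}"
proof -
  interpret nomulti_digraph G by fact
  have "inj_on (head G) (out_arcs G u)"
    using no_multi_arcs by (auto simp: inj_on_def arc_to_ends_def)
  moreover have "head G ` out_arcs G u = {v. (u, v) \<in> arcs_ends G}"
    by (auto simp: arcs_ends_conv image_iff)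
  ultimately show ?thesis by (simp add: degree_def out_degree_def flip: card_image)
qed

lemma successively_imp_awalk:
  assumes "wf_digraph G" "xs \<noteq> []" "set xs \<subseteq> verts G"
    and "successively (\<lambda>u v. (u, v) \<in> arcs_ends G) xs"
  obtains p where "pre_digraph.awalk G (hd xs) p (last xs)" "pre_digraph.awalk_verts G (hd xs) p = xs"
proof -
  interpret wf_digraph G by fact
  have "\<exists>p. awalk (hd xs) p (last xs) \<and> awalk_verts (hd xs) p = xs"
    using assms(2-)
  proof (induction xs)
    case (Cons x xs)
    show ?case
    proof (cases "xs = []")
      case True
      then show ?thesis using Cons.prems by (intro exI[of _ "[]"]) (simp add: awalk_Nil_iff)
    next
      case False
      then obtain p where p: "awalk (hd xs) p (last xs)" "awalk_verts (hd xs) p = xs"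
        using Cons by (auto simp: successively_Cons)
      obtain a where "a \<in> arcs G" "tail G a = x" "head G a = hd xs"
        using Cons.prems False by (auto simp: successively_Cons elim: reachableE)
      then show ?thesis
        using p False by (intro exI[of _ "a # p"]) (simp add: awalk_Cons_iff)
    qed
  qed simp
  then show thesis using that by blast
qed

lemma finite_adjacency_of_graph:
  assumes "graph G"
  shows "finite_adjacency (verts G) (\<lambda>u v. (u, v) \<in> arcs_ends G)"
proof -
  interpret graph G by fact
  show ?thesis
    by unfold_locales
      (use adj_not_same adj_in_verts(1) arcs_ends_symmetric[OF sym_arcs] in auto)
qed

lemma k_connected_imp_connected_without:
  assumes "graph G" "k_connected k G" and S: "S \<subseteq> verts G" "card S < k"
  shows "finite_adjacency.connected_without (verts G) (\<lambda>u v. (u, v) \<in> arcs_ends G) S"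
  unfolding finite_adjacency.connected_without_def[OF finite_adjacency_of_graph[OF assms(1)]]
proof (intro ballI)
  interpret graph G by fact
  fix x y assume xy: "x \<in> verts G - S" "y \<in> verts G - S"
  let ?H = "G \<restriction> (verts G - S)"
  have ind: "induced_subgraph ?H G" by (rule induced_induce) auto
  interpret H: wf_digraph ?H using ind by (rule wf_digraphI_induced)
  \<comment> \<open>Symmetry upgrades connectedness to strong connectedness, which yields directed
    reachability.\<close>
  have "symmetric ?H" using sym_arcs ind by (rule induced_graph_imp_symmetric)
  moreover have "Digraph_Component.connected ?H"
    using S \<open>k_connected k G\<close> by (simp add: k_connected_def)
  ultimately have "strongly_connected ?H" by (rule H.symmetric_connected_imp_strongly_connected)
  then have "x \<rightarrow>\<^sup>*\<^bsub>?H\<^esub> y" using xy by (auto simp: strongly_connected_def)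
  then show "(\<lambda>u v. (u, v) \<in> arcs_ends G \<and> u \<in> verts G - S \<and> v \<in> verts G - S)\<^sup>*\<^sup>* x y"
  proof (induction rule: H.reachable_induct)
    case (step y z)
    have "(y, z) \<in> arcs_ends G" using step(2) by (rule dominates_induce_subgraphD)
    moreover have "y \<in> verts G - S" "z \<in> verts G - S"
      using H.adj_in_verts[OF step(2)] by simp_all
    ultimately show ?case using step.IH by (simp add: rtranclp.rtrancl_into_rtrancl)
  qed simp
qed

section \<open>The extremal graphs\<close>

context finite_adjacency
begin

text \<open>Alternate between the parts, starting in \<open>U\<close>, which may have one vertex
  more than \<open>W\<close>.\<close>

lemma hamiltonian_path_of_balanced_bipartite:
  assumes "finite U" "finite W" "V = U \<union> W" "U \<inter> W = {}"
    and "card W \<le> card U" "card U \<le> Suc (card W)"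
    and complete: "\<And>u w. u \<in> U \<Longrightarrow> w \<in> W \<Longrightarrow> E u w"
  obtains xs where "path xs" "set xs = V"
proof -
  obtain as where as: "set as = U" "distinct as" using assms(1) finite_distinct_list by blast
  obtain bs where bs: "set bs = W" "distinct bs" using assms(2) finite_distinct_list by blast
  have len: "length as = card U" "length bs = card W"
    using distinct_card[OF as(2)] distinct_card[OF bs(2)] as(1) bs(1) by simp_all
  let ?xs = "splice as bs"
  have "set ?xs = V" using as bs assms(3) by (simp add: set_shuffles[OF splice_in_shuffles])
  moreover have "distinct ?xs"
    using distinct_disjoint_shuffles[OF as(2) bs(2) _ splice_in_shuffles] as bs assms(4) by simp
  moreover have "successively E ?xs"
    by (rule successively_splice) (use as bs len assms(5,6) complete E_sym in auto)
  ultimately show thesis using that by (auto simp: path_def)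
qed

theorem hamiltonian_path_or_complete_bipartite:
  fixes k n e \<delta> \<Delta> :: nat
  assumes k: "1 \<le> k" "k < card V"
    and k_conn: "\<And>S. S \<subseteq> V \<Longrightarrow> card S < k \<Longrightarrow> connected_without S"
    and n: "n = card V" "n \<ge> 9"
    and e: "e = card edge_set"
    and \<delta>: "\<delta> = Min (deg ` V)"
    and \<Delta>: "\<Delta> = Max (deg ` V)"
    and zagreb: "(\<Sum>u\<in>V. (real (deg u))\<^sup>2) \<ge>
      (real n - real k - 2) * (real \<Delta>)\<^sup>2 +
      (real e * (real \<delta> + real n - real k - 2))\<^sup>2 /
        (4 * real \<delta> * (real n - real k - 2) * (real k + 2))"
    and non_ham: "\<nexists>xs. path xs \<and> set xs = V"
  obtains U W where "V = U \<union> W" "U \<inter> W = {}" "card U = k" "card W = k + 2"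
    "\<And>u v. E u v \<longleftrightarrow> u \<in> U \<and> v \<in> W \<or> u \<in> W \<and> v \<in> U"
proof -
  obtain I where I: "independent I" "card I = k + 2"
    by (rule hamiltonian_path_or_large_independent_set[of k]) (use k_conn non_ham in auto)
  define W where "W = V - I"
  define N where "N = card W"
  have IV: "I \<subseteq> V" and finI: "finite I" and finW: "finite W"
    using I finite_V by (auto simp: independent_def W_def intro: finite_subset)
  have "I \<noteq> {}" using I(2) by auto
  have "card V = card I + N"
    unfolding N_def W_def using IV finI by (simp add: card_Diff_subset card_mono finite_V)
  then have nN: "n = N + k + 2" using I n by simp
  have V_ne: "V \<noteq> {}" using k(2) by auto
  have deg_ge: "\<delta> \<le> deg u" if "u \<in> V" for u using that finite_V by (simp add: \<delta>)
  have deg_le: "deg u \<le> \<Delta>" if "u \<in> V" for u using that finite_V by (simp add: \<Delta>)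
  have "\<delta> \<in> deg ` V" unfolding \<delta> using V_ne finite_V by (intro Min_in) auto
  then have k_\<delta>: "k \<le> \<delta>" using deg_ge_connectivity[of k] k_conn k(2) by blast
  have nbrs_I: "nbrs u \<subseteq> W" if "u \<in> I" for u
    using that I nbrs_subset by (auto simp: independent_def nbrs_def W_def)
  have deg_I: "deg u \<le> N" if "u \<in> I" for u
    unfolding deg_def N_def using nbrs_I[OF that] finW by (rule card_mono[rotated])
  have "\<delta> \<le> N" using \<open>I \<noteq> {}\<close> deg_I deg_ge IV by (meson equals0I le_trans subsetD)

  let ?Y = "(real e * (real \<delta> + real N))\<^sup>2 / (4 * real \<delta> * real N * real (card I))"
  have sum_split: "(\<Sum>u\<in>V. (real (deg u))\<^sup>2) = (\<Sum>u\<in>I. (real (deg u))\<^sup>2) + (\<Sum>u\<in>W. (real (deg u))\<^sup>2)"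
    unfolding W_def using sum.subset_diff[OF IV finite_V] by (simp add: add.commute)
  have arith: "real n - real k - 2 = real N" "real \<delta> + real n - real k - 2 = real \<delta> + real N"
    "real k + 2 = real (card I)" using nN I by simp_all
  have zagreb': "real N * (real \<Delta>)\<^sup>2 + ?Y \<le> (\<Sum>u\<in>I. (real (deg u))\<^sup>2) + (\<Sum>u\<in>W. (real (deg u))\<^sup>2)"
    using zagreb unfolding arith sum_split .
  have W_sum: "(\<Sum>w\<in>W. (real \<Delta>)\<^sup>2 - (real (deg w))\<^sup>2) = real N * (real \<Delta>)\<^sup>2 - (\<Sum>u\<in>W. (real (deg u))\<^sup>2)"
    by (simp add: sum_subtractf N_def)
  have W_nonneg: "0 \<le> (real \<Delta>)\<^sup>2 - (real (deg w))\<^sup>2" if "w \<in> W" for w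
    using deg_le[of w] that by (simp add: W_def power_mono)
  have W_le: "(\<Sum>u\<in>W. (real (deg u))\<^sup>2) \<le> real N * (real \<Delta>)\<^sup>2"
    using sum_nonneg[of W "\<lambda>w. (real \<Delta>)\<^sup>2 - (real (deg w))\<^sup>2"] W_nonneg W_sum by simp
  \<comment> \<open>As the vertices of \<open>W\<close> contribute at most
    \<open>N * \<Delta>\<^sup>2\<close>, the second summand must be covered by \<open>I\<close>;
    this is the reverse bound that \<open>polya_szego_equality\<close> asks for.\<close>
  have Y_le: "?Y \<le> (\<Sum>u\<in>I. (real (deg u))\<^sup>2)" using zagreb' W_le by linarith
  have sum_le: "(\<Sum>u\<in>I. real (deg u)) \<le> real e"
    using independent_edge_count(1)[OF I(1)] by (simp add: e flip: of_nat_sum)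
  \<comment> \<open>From \<open>1 \<le> k\<close>, \<open>k \<le> \<delta>\<close> and
    \<open>\<delta> \<le> N\<close>; hence the denominator of \<open>?Y\<close> is positive.\<close>
  have pos: "0 < real \<delta>" "real \<delta> \<le> real N" using k k_\<delta> \<open>\<delta> \<le> N\<close> by simp_all
  have bounds: "\<forall>u\<in>I. real \<delta> \<le> real (deg u) \<and> real (deg u) \<le> real N"
    using deg_ge deg_I IV by auto
  note equality = polya_szego_equality[of I "real \<delta>" "real N" "\<lambda>u. real (deg u)" "real e",
      OF finI \<open>I \<noteq> {}\<close> pos bounds sum_le Y_le]
  have I_deg: "deg u = \<delta> \<or> deg u = N" if "u \<in> I" for u using equality(1)[OF that] by simp
  have sum_e: "(\<Sum>u\<in>I. deg u) = card edge_set"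
    using equality(3) by (simp add: e flip: of_nat_sum)
  have indW: "independent W"
    unfolding W_def using independent_edge_count(2)[OF I(1) sum_e] .
  \<comment> \<open>The sum over \<open>I\<close> now equals \<open>?Y\<close>, so nothing is lost
    on \<open>W\<close> either.\<close>
  have "(\<Sum>w\<in>W. (real \<Delta>)\<^sup>2 - (real (deg w))\<^sup>2) = 0"
    using W_sum W_le zagreb' equality(4) by linarith
  then have "\<forall>w\<in>W. (real \<Delta>)\<^sup>2 - (real (deg w))\<^sup>2 = 0"
    by (subst sum_nonneg_eq_0_iff[symmetric]) (use finW W_nonneg in auto)
  then have W_deg: "deg w = \<Delta>" if "w \<in> W" for w using that by simp
  have "(\<Sum>u\<in>I. deg u) = (\<Sum>w\<in>W. deg w)"
    unfolding W_def using bipartite_sum_deg_eq[OF I(1)] indW by (simp add: W_def)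
  then have sum_I: "(\<Sum>u\<in>I. deg u) = N * \<Delta>" using W_deg by (simp add: N_def)

  have N_eq: "N = \<delta>"
  proof (rule ccontr)
    assume "N \<noteq> \<delta>"
    then have "\<delta> < N" using \<open>\<delta> \<le> N\<close> by simp
    define A B where "A = {u \<in> I. deg u = \<delta>}" and "B = {u \<in> I. deg u = N}"
    have AB: "I = A \<union> B" "A \<inter> B = {}" "finite A" "finite B"
      using I_deg \<open>\<delta> < N\<close> finI by (auto simp: A_def B_def)
    have cards: "card A + card B = k + 2" using AB I(2) by (simp add: card_Un_disjoint)
    have sum_AB: "(\<Sum>u\<in>I. deg u) = card A * \<delta> + card B * N"
      using AB by (simp add: sum.union_disjoint) (simp add: A_def B_def)
    define p q where "p = card A" and "q = card B"
    have "(real \<delta> + real N) * (real p * real \<delta> + real q * real N)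
        = 2 * real \<delta> * real N * (real p + real q)"
    proof -
      have "(\<Sum>u\<in>I. real (deg u)) = real p * real \<delta> + real q * real N"
        using arg_cong[OF sum_AB, of real] by (simp add: p_def q_def)
      moreover have "real (card I) = real p + real q" using cards I(2) by (simp add: p_def q_def)
      ultimately show ?thesis using equality(2) by (simp only:)
    qed
    \<comment> \<open>The equality condition factors; \<open>\<delta> < N\<close> leaves only the
      second factor.\<close>
    then have "(real N - real \<delta>) * (real q * real N - real p * real \<delta>) = 0"
      by (simp add: algebra_simps)
    then have "real q * real N = real p * real \<delta>" using \<open>\<delta> < N\<close> by simp
    then have "real (p * \<delta>) = real (q * N)" by simp
    then have "p * \<delta> = q * N" by (simp only: of_nat_eq_iff)
    moreover have "N \<le> \<Delta>" if "q > 0"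
    proof -
      have "B \<noteq> {}" using that by (auto simp: q_def)
      then show ?thesis using deg_le IV by (auto simp: B_def)
    qed
    ultimately have "N = 2 \<and> k = 1"
      using unbalanced_equality_case[of p q k \<delta> N \<Delta>] cards sum_AB sum_I k_\<delta> \<open>\<delta> < N\<close> k(1)
      by (simp add: p_def q_def)
    \<comment> \<open>Here \<open>n = N + k + 2 = 5\<close>, contradicting
      \<open>n \<ge> 9\<close>.\<close>
    then show False using nN n by simp
  qed
  have complete: "E u w" if "u \<in> I" "w \<in> W" for u w
  proof -
    have "card (nbrs u) = card W" using I_deg[OF that(1)] N_eq by (auto simp: deg_def N_def)
    then have "nbrs u = W" using nbrs_I[OF that(1)] finW card_subset_eq by blast
    then show ?thesis using that by (auto simp: nbrs_def)
  qed
  have VIW: "V = W \<union> I" "W \<inter> I = {}" using IV by (auto simp: W_def)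
  \<comment> \<open>A vertex of \<open>W\<close> has all its neighbours in \<open>I\<close>, and at
    least \<open>\<delta> = N\<close> of them.\<close>
  have "N \<le> k + 2"
  proof -
    have "W \<noteq> {}" using N_eq k k_\<delta> by (auto simp: N_def)
    then obtain w where w: "w \<in> W" by blast
    have "nbrs w \<subseteq> I" using indW w VIW(1) nbrs_subset[of w] unfolding independent_def nbrs_def by blast
    then have "deg w \<le> k + 2" unfolding deg_def I(2)[symmetric] by (rule card_mono[OF finI])
    moreover have "\<delta> \<le> deg w" using deg_ge w VIW by blast
    ultimately show ?thesis using N_eq by simp
  qed
  have "N = k"
  proof (rule ccontr)
    \<comment> \<open>As \<open>k \<le> \<delta> = N\<close>, only \<open>N = k + 1\<close> and
      \<open>N = k + 2\<close> remain, and then an alternating path starting in \<open>I\<close>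
      visits every vertex.\<close>
    assume "N \<noteq> k"
    then have "card W \<le> card I" "card I \<le> Suc (card W)"
      using \<open>N \<le> k + 2\<close> k_\<delta> N_eq I(2) by (simp_all add: N_def)
    then show False
      using hamiltonian_path_of_balanced_bipartite[of I W] finI finW VIW complete non_ham by blast
  qed
  have "E u v \<longleftrightarrow> u \<in> W \<and> v \<in> I \<or> u \<in> I \<and> v \<in> W" for u v
    using complete[of u v] complete[of v u] E_sym[of u v] E_sym[of v u] E_in_V I(1) indW VIW
    unfolding independent_def by blast
  then show thesis using that[of W I] VIW I(2) \<open>N = k\<close> by (simp add: N_def)
qed

end

section \<open>Transfer to digraphs\<close>

theorem theorem2:
  fixes G :: "('a, 'b) pre_digraph" and k n e \<delta> \<Delta> :: nat
  assumes "graph G"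
    and "k \<ge> 1"
    and "k_connected k G"
    and "n = card (verts G)" and "n \<ge> 9"
    and "e = card (edges G)"
    and "\<delta> = min_degree G"
    and "\<Delta> = max_degree G"
    and "real (first_zagreb_index G) \<ge>
      (real n - real k - 2) * (real \<Delta>)\<^sup>2 +
      (real e * (real \<delta> + real n - real k - 2))\<^sup>2 /
        (4 * real \<delta> * (real n - real k - 2) * (real k + 2))"
  shows "traceable G \<or> complete_bipartite_digraph k (k + 2) G"
proof -
  interpret graph G by fact
  interpret finite_adjacency "verts G" "\<lambda>u v. (u, v) \<in> arcs_ends G"
    using \<open>graph G\<close> by (rule finite_adjacency_of_graph)
  have deg: "degree G = deg"
    by (rule ext) (simp add: degree_eq_card_successors nomulti_digraph deg_def nbrs_def)
  have edges: "edges G = edge_set" by (simp add: edges_def edge_set_def)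
  have k_conn: "connected_without S" if "S \<subseteq> verts G" "card S < k" for S
    using k_connected_imp_connected_without[OF \<open>graph G\<close> assms(3) that] .
  show ?thesis
  proof (cases "\<exists>xs. path xs \<and> set xs = verts G")
    case True
    then obtain xs where xs: "path xs" "set xs = verts G" by blast
    \<comment> \<open>The empty list counts as a \<open>path\<close> but is no vertex list of a
      walk; \<open>n \<ge> 9\<close> excludes it.\<close>
    have "xs \<noteq> []" using xs assms(4,5) by auto
    with xs obtain p where "awalk (hd xs) p (last xs)" "awalk_verts (hd xs) p = xs"
      using successively_imp_awalk[OF wf_digraph] unfolding path_def by blast
    then have "apath (hd xs) p (last xs)" "set (awalk_verts (hd xs) p) = verts G"
      using xs by (simp_all add: apath_def path_def)
    then show ?thesis unfolding traceable_def by blast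
  next
    case False
    have k_lt: "k < card (verts G)" using assms(3) by (simp add: k_connected_def)
    have eqs: "e = card edge_set" "\<delta> = Min (deg ` verts G)" "\<Delta> = Max (deg ` verts G)"
      using assms(6-8) by (simp_all add: edges min_degree_def max_degree_def deg)
    have zagreb: "real (first_zagreb_index G) = (\<Sum>u\<in>verts G. (real (deg u))\<^sup>2)"
      by (simp add: first_zagreb_index_def deg)
    obtain U W where "verts G = U \<union> W" "U \<inter> W = {}" "card U = k" "card W = k + 2"
      "\<And>u v. (u, v) \<in> arcs_ends G \<longleftrightarrow> u \<in> U \<and> v \<in> W \<or> u \<in> W \<and> v \<in> U"
      by (rule hamiltonian_path_or_complete_bipartite[OF assms(2) k_lt _ assms(4,5) eqs
            assms(9)[unfolded zagreb] False]) (erule (1) k_conn, rule that)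
    then have "complete_bipartite_digraph k (k + 2) G"
      unfolding complete_bipartite_digraph_def using \<open>graph G\<close>
      by (intro conjI exI[of _ U] exI[of _ W]) auto
    then show ?thesis ..
  qed
qed

end
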